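(* For every integer $d\geq 3$, $$u(d) = F_C^{(d)}\left(1,\tfrac12;1,\ldots,1;\tfrac{1}{d^2},\ldots,\tfrac{1}{d^2}\right),$$ where $$u(d)=\int_0^\infty\left[I_0\left(\frac{x}{d}\right)\right]^d \mathrm{e}^{-x}\,\mathrm{d}x,$$ and, on the right-hand side, both the parameter $1$ (after the first semicolon) and the argument $\tfrac1{d^2}$ are repeated $d$ times.
   Context: $I_0$ denotes the modified Bessel function of the first kind of order zero, $I_0(x)=\sum_{k\geq 0}\frac{1}{(k!)^2}\left(\frac{x}{2}\right)^{2k}$. The Lauricella function $F_C^{(d)}$ of $d$ variables is defined by the series $$F_C^{(d)}(a,b;c_1,\ldots,c_d;x_1,\ldots,x_d)=\sum_{k_1\geq 0}\cdots\sum_{k_d\geq 0}\frac{(a)_{k_1+\cdots+k_d}\,(b)_{k_1+\cdots+k_d}}{(c_1)_{k_1}\cdots(c_d)_{k_d}}\,\frac{x_1^{k_1}\cdots x_d^{k_d}}{k_1!\cdots k_d!},$$ where $(f)_k=f(f+1)\cdots(f+k-1)$, with $(f)_0=1$, is the Pochhammer symbol (ascending factorial). *)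

theory Defs
  imports "HOL-Analysis.Analysis"
begin

definition bessel_I0 :: "real \<Rightarrow> real" where
  "bessel_I0 x = (\<Sum>k. 1 / (fact k)\<^sup>2 * (x / 2) ^ (2 * k))"

text \<open>
  The Lauricella function \<open>F\<^sub>C\<close> of \<open>d\<close> variables. A multi-index \<open>(k\<^sub>1, \<dots>, k\<^sub>d)\<close> is an
  extensional function on \<open>{1..d}\<close>, and likewise only the values of \<open>c\<close> and \<open>x\<close> on
  \<open>{1..d}\<close> matter. The multiple series is an unordered sum over all multi-indices; as \<open>infsum\<close>
  is 0 for families that are not summable, convergence has to be stated separately.
\<close>

definition lauricella_FC_term ::
  "nat \<Rightarrow> 'a \<Rightarrow> 'a \<Rightarrow> (nat \<Rightarrow> 'a) \<Rightarrow> (nat \<Rightarrow> 'a) \<Rightarrow> (nat \<Rightarrow> nat) \<Rightarrow> 'a::real_normed_field" where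
  "lauricella_FC_term d a b c x k =
     pochhammer a (\<Sum>i=1..d. k i) * pochhammer b (\<Sum>i=1..d. k i) / (\<Prod>i=1..d. pochhammer (c i) (k i))
       * ((\<Prod>i=1..d. x i ^ k i) / (\<Prod>i=1..d. fact (k i)))"

definition lauricella_FC ::
  "nat \<Rightarrow> 'a \<Rightarrow> 'a \<Rightarrow> (nat \<Rightarrow> 'a) \<Rightarrow> (nat \<Rightarrow> 'a) \<Rightarrow> 'a::real_normed_field" where
  "lauricella_FC d a b c x =
     (\<Sum>\<^sub>\<infinity>k\<in>{1..d} \<rightarrow>\<^sub>E UNIV. lauricella_FC_term d a b c x k)"

definition u_integrand :: "nat \<Rightarrow> real \<Rightarrow> real" where
  "u_integrand d x = bessel_I0 (x / real d) ^ d * exp (- x)"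

definition u :: "nat \<Rightarrow> real" where
  "u d = (LINT x:{0..}|lborel. u_integrand d x)"

end

theory Submission
  imports Defs "HOL-Probability.Distributions"
begin

text \<open>
  Expand each of the \<open>d\<close> factors of \<open>I\<^sub>0(x/d)\<^sup>d\<close> into its power series and integrate against
  \<open>e\<^sup>-\<^sup>x\<close> term by term. A multi-index \<open>k\<close> with \<open>n = k\<^sub>1 + \<dots> + k\<^sub>d\<close> contributes a multiple of
  \<open>x\<^sup>2\<^sup>n e\<^sup>-\<^sup>x\<close>, whose integral is \<open>(2n)! = 4\<^sup>n (1)\<^sub>n (1/2)\<^sub>n\<close>; this is where the two upper parameters
  of the Lauricella function come from, and the factor \<open>4\<^sup>n\<close> cancels the halves in the Bessel series.
  All terms are nonnegative, so Tonelli's theorem gives the identity in the extended reals for every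
  \<open>d\<close> (lemma \<open>nn_integral_u_integrand\<close>).

  Only finiteness depends on \<open>d\<close>. The series sits on the boundary of its domain of convergence,
  so it is easier to show that the integral is finite and to deduce that the series converges.
  The bound \<open>I\<^sub>0(x) \<le> e\<^sup>x / \<surd>(1 + x)\<close> (lemma \<open>bessel_I0_le\<close>) dominates the integrand by
  \<open>(1 + x/d)\<close> to the power \<open>-d/2\<close>, which is integrable exactly when \<open>d > 2\<close>.
\<close>

section \<open>The growth of the Bessel function\<close>

lemma paired_exp_terms_sums:
  "(\<lambda>k. x ^ (2 * k) / fact (2 * k) + x ^ (2 * k + 1) / fact (2 * k + 1)) sums exp (x :: real)"
proof -
  have "(\<lambda>n. x ^ n / fact n) sums exp x"
    using exp_converges[of x] by (simp add: divide_inverse mult.commute)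
  from sums_group[OF this, of 2] show ?thesis
    by (simp add: numeral_2_eq_2 mult.commute)
qed

text \<open>
  Wallis' bound for \<open>(2k choose k) / 4\<^sup>k\<close>, the quantity squared on the left. The ratio of consecutive
  squares, \<open>(2k + 1)\<^sup>2 / (2k + 2)\<^sup>2\<close>, is at most the ratio \<open>(2k + 1) / (2k + 3)\<close> of
  the bounds, by AM-GM.
\<close>

lemma central_binomial_sq_le:
  "(fact (2 * k) / (4 ^ k * (fact k)\<^sup>2))\<^sup>2 \<le> 1 / (2 * real k + 1)"
proof (induction k)
  case 0
  then show ?case by simp
next
  case (Suc k)
  define r :: real where "r = fact (2 * k) / (4 ^ k * (fact k)\<^sup>2)"
  have "fact (2 * Suc k) / (4 ^ Suc k * (fact (Suc k))\<^sup>2)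
      = r * ((2 * real k + 1) / (2 * real k + 2))"
    by (simp add: r_def divide_simps power2_eq_square) (simp add: algebra_simps)
  then have "(fact (2 * Suc k) / (4 ^ Suc k * (fact (Suc k))\<^sup>2))\<^sup>2
      = r\<^sup>2 * ((2 * real k + 1) / (2 * real k + 2))\<^sup>2"
    by (simp only: power_mult_distrib)
  also have "\<dots> \<le> 1 / (2 * real k + 1) * ((2 * real k + 1) / (2 * real k + 2))\<^sup>2"
    using Suc.IH by (intro mult_right_mono) (simp_all add: r_def)
  also have "\<dots> \<le> 1 / (2 * real (Suc k) + 1)"
    by (simp add: divide_simps power2_eq_square) (simp add: algebra_simps)
  finally show ?case .
qed

lemma bessel_I0_term_eq:
  "1 / (fact k)\<^sup>2 * (x / 2) ^ (2 * k)
    = fact (2 * k) / (4 ^ k * (fact k)\<^sup>2) * (x ^ (2 * k) / fact (2 * k))" for x :: real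
  by (simp add: power_divide power_mult)

text \<open>
  Write the \<open>k\<close>-th term of \<open>I\<^sub>0\<close> as \<open>r a\<close> with \<open>a\<close> the corresponding term of \<open>cosh\<close> and
  \<open>r = (2k choose k) / 4\<^sup>k\<close>. For \<open>s = \<surd>(1 + x)\<close>, AM-GM gives \<open>r \<le> (s r\<^sup>2 + 1/s) / 2\<close>, and Wallis'
  bound makes \<open>s r\<^sup>2 a\<close> at most \<open>(a + a x / (2k + 1)) / s\<close>, where \<open>a x / (2k + 1)\<close> is the \<open>k\<close>-th term
  of \<open>sinh\<close>. Pairing the terms of \<open>cosh\<close> and \<open>sinh\<close> lets the bounds sum to \<open>e\<^sup>x / s\<close>.
\<close>

lemma bessel_I0_term_le:
  fixes x :: real
  assumes "0 \<le> x"
  shows "1 / (fact k)\<^sup>2 * (x / 2) ^ (2 * k)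
    \<le> (x ^ (2 * k) / fact (2 * k) + x ^ (2 * k + 1) / fact (2 * k + 1)) / sqrt (1 + x)"
proof -
  define r :: real where "r = fact (2 * k) / (4 ^ k * (fact k)\<^sup>2)"
  define a where "a = x ^ (2 * k) / fact (2 * k)"
  define s where "s = sqrt (1 + x)"
  define m where "m = 2 * real k + 1"
  have a: "a \<ge> 0" and s: "s > 0" and s2: "s\<^sup>2 = 1 + x" and m: "m \<ge> 1"
    using assms by (auto simp: a_def s_def m_def)
  have odd: "x ^ (2 * k + 1) / fact (2 * k + 1) = a * (x / m)"
    by (simp add: a_def m_def algebra_simps)
  have "2 * (r * s) \<le> (r * s)\<^sup>2 + 1"
    using sum_squares_bound[of "r * s" 1] by simp
  also have "(r * s)\<^sup>2 \<le> (1 + x) / m"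
    using mult_right_mono[OF central_binomial_sq_le[of k, folded r_def m_def], of "1 + x"] assms
    by (simp only: power_mult_distrib s2) simp
  also have "(1 + x) / m + 1 \<le> 2 * (1 + x / m)"
  proof -
    have "(1 + x) / m \<le> 1 + x / m"
      using m by (simp add: add_divide_distrib)
    moreover have "0 \<le> x / m"
      using m assms by simp
    ultimately show ?thesis
      unfolding distrib_left[of 2] by simp
  qed
  finally have "r * s \<le> 1 + x / m"
    by simp
  then have "a * (r * s) \<le> a * (1 + x / m)"
    using a by (intro mult_left_mono)
  then have "r * a \<le> (a + a * (x / m)) / s"
    using s by (simp add: pos_le_divide_eq algebra_simps)
  then show ?thesis
    unfolding bessel_I0_term_eq odd by (simp only: r_def a_def s_def)
qed

lemma bessel_I0_summable: "summable (\<lambda>k. 1 / (fact k)\<^sup>2 * (x / 2) ^ (2 * k))" for x :: real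
proof -
  have "summable (\<lambda>k. 1 / (fact k)\<^sup>2 * (\<bar>x\<bar> / 2) ^ (2 * k))"
    using bessel_I0_term_le[of "\<bar>x\<bar>"]
    by (intro summable_comparison_test'
          [OF summable_divide[OF sums_summable[OF paired_exp_terms_sums[of "\<bar>x\<bar>"]],
            of "sqrt (1 + \<bar>x\<bar>)"]]) simp_all
  then show ?thesis
    by (simp add: power_mult power_divide)
qed

lemma bessel_I0_nonneg: "0 \<le> bessel_I0 x"
  unfolding bessel_I0_def by (intro suminf_nonneg bessel_I0_summable) simp

lemma bessel_I0_le:
  assumes "0 \<le> x"
  shows "bessel_I0 x \<le> exp x / sqrt (1 + x)"
proof -
  have "(\<lambda>k. (x ^ (2 * k) / fact (2 * k) + x ^ (2 * k + 1) / fact (2 * k + 1)) / sqrt (1 + x))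
      sums (exp x / sqrt (1 + x))"
    by (intro sums_divide paired_exp_terms_sums)
  then show ?thesis
    unfolding bessel_I0_def using assms
    by (metis (no_types, lifting) bessel_I0_summable bessel_I0_term_le sums_le summable_sums)
qed

lemma bessel_I0_measurable [measurable]: "bessel_I0 \<in> borel_measurable borel"
  unfolding bessel_I0_def[abs_def] by measurable

lemma u_integrand_measurable [measurable]: "u_integrand d \<in> borel_measurable borel"
  unfolding u_integrand_def[abs_def] by measurable

lemma u_integrand_nonneg: "0 \<le> u_integrand d x"
  by (simp add: u_integrand_def bessel_I0_nonneg)

section \<open>Finiteness of the integral\<close>

lemma u_integrand_le:
  assumes "d > 0" and "0 \<le> x"
  shows "u_integrand d x \<le> (1 + x / real d) powr (- real d / 2)"
proof -
  define y where "y = x / real d"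
  have y: "0 \<le> y" and x: "x = real d * y"
    using assms by (simp_all add: y_def)
  have "u_integrand d x = (bessel_I0 y * exp (- y)) ^ d"
    by (simp add: u_integrand_def y_def[symmetric] power_mult_distrib exp_of_nat_mult[symmetric] x)
  also have "\<dots> \<le> (1 / sqrt (1 + y)) ^ d"
    using bessel_I0_le[OF y] bessel_I0_nonneg[of y]
    by (intro power_mono) (simp_all add: exp_minus field_simps)
  also have "\<dots> = (1 + y) powr (- real d / 2)"
  proof -
    have "1 / sqrt (1 + y) = (1 + y) powr (- 1 / 2)"
      using y by (simp add: powr_minus_divide powr_half_sqrt[symmetric] del: powr_half_sqrt)
    then show ?thesis
      using y by (simp add: powr_power)
  qed
  finally show ?thesis
    by (simp add: y_def)
qed

lemma nn_integral_u_integrand_finite: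
  assumes "d \<ge> 3"
  shows "(\<integral>\<^sup>+x. ennreal (u_integrand d x) * indicator {0..} x \<partial>lborel) < \<infinity>"
proof -
  define p where "p = real d / 2 - 1"
  define f where "f = (\<lambda>x. (1 + x / real d) powr (- real d / 2))"
  define F where "F = (\<lambda>x. - (real d / p) * (1 + x / real d) powr (- p))"
  have p: "p > 0" and d: "real d > 0"
    using assms by (simp_all add: p_def)
  have "(\<integral>\<^sup>+x. ennreal (u_integrand d x) * indicator {0..} x \<partial>lborel)
      \<le> (\<integral>\<^sup>+x. ennreal (f x) * indicator {0..} x \<partial>lborel)"
    using u_integrand_le[of d] d
    by (intro nn_integral_mono) (auto simp: f_def indicator_def intro!: ennreal_leI)
  also have "\<dots> = ennreal (0 - F 0)"
  proof (rule nn_integral_FTC_atLeast)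
    show "f \<in> borel_measurable borel"
      unfolding f_def by measurable
    show "0 \<le> f x" for x
      by (simp add: f_def)
    show "(F has_real_derivative f x) (at x)" if "0 \<le> x" for x
    proof -
      have "1 + x / real d > 0"
        using d that by (simp add: add_pos_nonneg)
      then have "(F has_real_derivative
          - (real d / p) * (- p * (1 + x / real d) powr (- p - 1) * (1 / real d))) (at x)"
        unfolding F_def using d by (auto intro!: derivative_eq_intros)
      moreover have "- p - 1 = - real d / 2"
        by (simp add: p_def)
      ultimately show ?thesis
        using p d by (simp add: f_def)
    qed
    show "(F \<longlongrightarrow> 0) at_top"
    proof -
      have "filterlim (\<lambda>x. 1 + x / real d) at_top at_top"
        using filterlim_tendsto_add_at_top[OF tendsto_const
            filterlim_tendsto_pos_mult_at_top[OF tendsto_const _ filterlim_ident],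
            of "1 / real d" 1] d
        by simp
      from tendsto_mult_right_zero[OF tendsto_neg_powr[OF _ this, of "- p"], of "- (real d / p)"] p
      show ?thesis
        unfolding F_def by simp
    qed
  qed
  also have "\<dots> < \<infinity>"
    by simp
  finally show ?thesis .
qed

section \<open>Termwise integration\<close>

text \<open>
  Stated for summation as integration against counting measure, the form to which Tonelli's
  theorem applies.
\<close>

lemma bessel_I0_power_eq_infsetsum:
  fixes y :: real
  shows "Infinite_Set_Sum.abs_summable_on
      (\<lambda>k. \<Prod>i=1..d. 1 / (fact (k i))\<^sup>2 * (y / 2) ^ (2 * k i)) ({1..d} \<rightarrow>\<^sub>E UNIV)"
    and "bessel_I0 y ^ d
      = (\<Sum>\<^sub>ak\<in>{1..d} \<rightarrow>\<^sub>E UNIV. \<Prod>i=1..d. 1 / (fact (k i))\<^sup>2 * (y / 2) ^ (2 * k i))"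
proof -
  let ?f = "\<lambda>n. 1 / (fact n)\<^sup>2 * (y / 2) ^ (2 * n)"
  have f: "Infinite_Set_Sum.abs_summable_on ?f UNIV"
    using bessel_I0_summable[of y] by (simp add: abs_summable_on_nat_iff' power_mult)
  show "Infinite_Set_Sum.abs_summable_on (\<lambda>k. \<Prod>i=1..d. ?f (k i)) ({1..d} \<rightarrow>\<^sub>E UNIV)"
    using abs_summable_on_prod_PiE[of "{1..d}" "\<lambda>_. UNIV" "\<lambda>_. ?f"] f by simp
  have "(\<Sum>\<^sub>ak\<in>{1..d} \<rightarrow>\<^sub>E UNIV. \<Prod>i=1..d. ?f (k i)) = (\<Prod>i=1..d. infsetsum ?f UNIV)"
    using f by (intro infsetsum_prod_PiE) simp_all
  also have "\<dots> = bessel_I0 y ^ d"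
    using infsetsum_nat'[OF f] by (simp add: bessel_I0_def)
  finally show "bessel_I0 y ^ d = (\<Sum>\<^sub>ak\<in>{1..d} \<rightarrow>\<^sub>E UNIV. \<Prod>i=1..d. ?f (k i))" ..
qed

abbreviation bessel_lauricella_term :: "nat \<Rightarrow> (nat \<Rightarrow> nat) \<Rightarrow> real" where
  "bessel_lauricella_term d \<equiv> lauricella_FC_term d 1 (1/2) (\<lambda>_. 1) (\<lambda>_. 1 / (real d)\<^sup>2)"

lemma bessel_lauricella_term_nonneg: "0 \<le> bessel_lauricella_term d k"
  unfolding lauricella_FC_term_def
  by (intro mult_nonneg_nonneg divide_nonneg_nonneg prod_nonneg) (simp_all add: pochhammer_nonneg)

text \<open>
  The factor \<open>(1)\<^sub>n (1/2)\<^sub>n\<close> is \<open>(2n)! / 4\<^sup>n\<close> by the duplication formula, hence the coefficient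
  of \<open>x\<^sup>2\<^sup>n\<close> on the left is the Lauricella term stripped of the Gamma integral \<open>(2n)!\<close>.
\<close>

lemma bessel_I0_product_term_eq:
  fixes x :: real and k :: "nat \<Rightarrow> nat" and d :: nat
  defines "n \<equiv> \<Sum>i=1..d. k i"
  shows "(\<Prod>i=1..d. 1 / (fact (k i))\<^sup>2 * (x / real d / 2) ^ (2 * k i))
    = bessel_lauricella_term d k / fact (2 * n) * x ^ (2 * n)"
proof -
  have "(\<Prod>i=1..d. 1 / (fact (k i))\<^sup>2 * (x / real d / 2) ^ (2 * k i))
      = (x / real d / 2) ^ (2 * n) / (\<Prod>i=1..d. fact (k i))\<^sup>2"
    by (simp add: prod.distrib prod_dividef prod_power_distrib power_sum[symmetric]
        sum_distrib_left[symmetric] n_def)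
  moreover have "bessel_lauricella_term d k
      = fact n * pochhammer (1 / 2) n * (1 / (real d)\<^sup>2) ^ n / (\<Prod>i=1..d. fact (k i))\<^sup>2"
    by (simp add: lauricella_FC_term_def n_def pochhammer_fact[symmetric]
        power_sum[symmetric] power2_eq_square prod.distrib)
  moreover have "(fact (2 * n) :: real) = 4 ^ n * (fact n * pochhammer (1 / 2) n)"
    using fact_double[where ?'a = real, of n] by (simp add: power_mult)
  moreover have "pochhammer (1 / 2 :: real) n > 0"
    by (rule pochhammer_pos) simp
  ultimately show ?thesis
    by (simp add: power_divide power_mult)
qed

lemma nn_integral_u_integrand:
  "(\<integral>\<^sup>+x. ennreal (u_integrand d x) * indicator {0..} x \<partial>lborel)
    = (\<integral>\<^sup>+k. ennreal (bessel_lauricella_term d k) \<partial>count_space ({1..d} \<rightarrow>\<^sub>E UNIV))"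
proof -
  let ?I = "{1..d} \<rightarrow>\<^sub>E (UNIV :: nat set)"
  let ?n = "\<lambda>k. \<Sum>i=1..d. k i"
  define c where "c k = bessel_lauricella_term d k / fact (2 * ?n k)" for k
  define t where "t k x = ennreal (c k) * (ennreal (x ^ (2 * ?n k) * exp (- x)) * indicator {0..} x)"
    for k and x :: real
  have c: "c k \<ge> 0" for k
    by (simp add: c_def bessel_lauricella_term_nonneg)
  have "ennreal (u_integrand d x) * indicator {0..} x = (\<integral>\<^sup>+k. t k x \<partial>count_space ?I)" for x
  proof -
    let ?g = "\<lambda>k. \<Prod>i=1..d. 1 / (fact (k i))\<^sup>2 * (x / real d / 2) ^ (2 * k i)"
    have t: "t k x = ennreal (?g k) * (ennreal (exp (- x)) * indicator {0..} x)" for k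
      unfolding bessel_I0_product_term_eq c_def[symmetric] t_def
      using c by (simp add: ennreal_mult mult_ac)
    have "ennreal (bessel_I0 (x / real d) ^ d) = (\<integral>\<^sup>+k. ennreal (?g k) \<partial>count_space ?I)"
      unfolding bessel_I0_power_eq_infsetsum(2)
      by (rule nn_integral_conv_infsetsum[OF bessel_I0_power_eq_infsetsum(1), symmetric])
         (intro prod_nonneg, simp)
    then have "ennreal (u_integrand d x) * indicator {0..} x
        = (\<integral>\<^sup>+k. ennreal (?g k) \<partial>count_space ?I) * (ennreal (exp (- x)) * indicator {0..} x)"
      by (simp only: u_integrand_def ennreal_mult zero_le_power bessel_I0_nonneg exp_ge_zero mult_ac)
    also have "\<dots> = (\<integral>\<^sup>+k. t k x \<partial>count_space ?I)"
      unfolding t by (rule nn_integral_multc[symmetric]) simp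
    finally show ?thesis .
  qed
  then have "(\<integral>\<^sup>+x. ennreal (u_integrand d x) * indicator {0..} x \<partial>lborel)
      = (\<integral>\<^sup>+x. \<integral>\<^sup>+k. t k x \<partial>count_space ?I \<partial>lborel)"
    by simp
  also have "\<dots> = (\<integral>\<^sup>+k. \<integral>\<^sup>+x. t k x \<partial>lborel \<partial>count_space ?I)"
    by (rule nn_integral_count_space_nn_integral) (simp_all add: countable_PiE t_def)
  also have "\<dots> = (\<integral>\<^sup>+k. ennreal (bessel_lauricella_term d k) \<partial>count_space ?I)"
  proof (rule nn_integral_cong)
    fix k
    have "(\<integral>\<^sup>+x. t k x \<partial>lborel) = ennreal (c k) * ennreal (fact (2 * ?n k))"
      unfolding t_def by (subst nn_integral_cmult) (simp_all add: nn_intergal_power_times_exp_Ici)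
    also have "\<dots> = ennreal (bessel_lauricella_term d k)"
      using c by (simp add: ennreal_mult[symmetric]) (simp add: c_def)
    finally show "(\<integral>\<^sup>+x. t k x \<partial>lborel) = ennreal (bessel_lauricella_term d k)" .
  qed
  finally show ?thesis .
qed

section \<open>The integral as a Lauricella function\<close>

theorem theorem2p1:
  fixes d :: nat
  assumes "d \<ge> 3"
  shows "set_integrable lborel {0..} (u_integrand d)
    \<and> (lauricella_FC_term d 1 (1/2) (\<lambda>_. 1) (\<lambda>_. 1 / (real d)\<^sup>2))
        summable_on ({1..d} \<rightarrow>\<^sub>E UNIV)
    \<and> u d = lauricella_FC d 1 (1/2) (\<lambda>_. 1) (\<lambda>_. 1 / (real d)\<^sup>2)"
proof -
  let ?I = "{1..d} \<rightarrow>\<^sub>E (UNIV :: nat set)"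
  let ?U = "\<lambda>x. indicator {0..} x *\<^sub>R u_integrand d x"
  have U_nonneg: "0 \<le> ?U x" for x
    by (simp add: u_integrand_nonneg)
  have U_eq: "(\<integral>\<^sup>+x. ennreal (?U x) \<partial>lborel)
      = (\<integral>\<^sup>+x. ennreal (u_integrand d x) * indicator {0..} x \<partial>lborel)"
    by (intro nn_integral_cong) (simp add: indicator_def)
  have U_finite: "(\<integral>\<^sup>+x. ennreal (?U x) \<partial>lborel) < \<infinity>"
    unfolding U_eq by (rule nn_integral_u_integrand_finite[OF assms])
  have U_integrable: "integrable lborel ?U"
    using U_finite U_nonneg by (intro integrableI_nonneg) simp_all
  have "integrable (count_space ?I) (bessel_lauricella_term d)"
    using U_finite unfolding U_eq nn_integral_u_integrand
    by (intro integrableI_nonneg) (simp_all add: bessel_lauricella_term_nonneg)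
  then have abs: "Infinite_Set_Sum.abs_summable_on (bessel_lauricella_term d) ?I"
    by (simp add: abs_summable_on_def)
  have summable: "bessel_lauricella_term d summable_on ?I"
    using abs abs_summable_equivalent summable_on_iff_abs_summable_on_real by blast
  have "ennreal (u d) = (\<integral>\<^sup>+x. ennreal (?U x) \<partial>lborel)"
    unfolding u_def set_lebesgue_integral_def
    using U_integrable U_nonneg by (intro nn_integral_eq_integral[symmetric]) simp_all
  also have "\<dots> = ennreal (infsetsum (bessel_lauricella_term d) ?I)"
    unfolding U_eq nn_integral_u_integrand
    using abs by (intro nn_integral_conv_infsetsum bessel_lauricella_term_nonneg)
  also have "\<dots> = ennreal (lauricella_FC d 1 (1/2) (\<lambda>_. 1) (\<lambda>_. 1 / (real d)\<^sup>2))"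
    by (simp only: infsetsum_infsum[OF abs] lauricella_FC_def)
  finally have "u d = lauricella_FC d 1 (1/2) (\<lambda>_. 1) (\<lambda>_. 1 / (real d)\<^sup>2)"
    using U_nonneg bessel_lauricella_term_nonneg[of d]
    by (subst (asm) ennreal_inj)
       (auto simp: u_def lauricella_FC_def set_lebesgue_integral_def
         intro!: Bochner_Integration.integral_nonneg infsum_nonneg)
  then show ?thesis
    using U_integrable summable by (simp add: set_integrable_def)
qed

end
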